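(* Let $x$ be a real number, let $n$ be a positive integer, and assume $|\epsilon_2|<|\epsilon_1|$. Then $$\prod_{r=1}^{n}\left(\epsilon_1^{r-1}-x\,\epsilon_2^{r-1}\right)^{-1}=\epsilon_1^{-\binom{n}{2}}\sum_{\kappa=0}^{\infty}\epsilon_1^{-\kappa(n-1)}\begin{bmatrix} n+\kappa-1\\ \kappa\end{bmatrix}x^{\kappa}.$$
   Context: Let $0<q<p\le 1$ be real numbers and let $\mathcal{R}$ be a meromorphic function of two variables. For real $u$ the $\mathcal{R}(p,q)$-deformed number is $[u]:=\mathcal{R}(p^u,q^u)$. Standing assumption: there are positive real numbers $\epsilon_1=\Phi_1(p,q)$, $\epsilon_2=\Phi_2(p,q)$ such that for all real $u,v$, $$[u+v]=\epsilon_1^{v}[u]+\epsilon_2^{u}[v],$$ and $[k]\neq0$ for every integer $k\ge1$. Define, for real $u$ and integer $\kappa\ge1$, the deformed factorial of $u$ of order $\kappa$ by $[u]_{\kappa}:=\prod_{v=1}^{\kappa}[u-v+1]$, with $[u]_0:=1$; the factorial $[k]!:=[1][2]\cdots[k]$, $[0]!:=1$; and the deformed binomial coefficient $\begin{bmatrix}u\\ \kappa\end{bmatrix}:=[u]_\kappa/[\kappa]!$ (all with respect to $\mathcal{R}(p,q)$).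
   Formalization: The identity is proved for |x|<1 only, together with the fact that the series converges exactly when |x|<1; for |x|≥1 the series diverges (e.g. n=1, x=2), so the claim for every real x fails. *)

theory Defs
  imports "HOL-Analysis.Analysis"
begin

text \<open>
  Functions of two complex variables are functions on pairs. Holomorphy (on an open set) is
  complex Frechet differentiability, i.e. the real derivative at each point is complex linear.
\<close>

definition holomorphic2_on :: "(complex \<times> complex \<Rightarrow> complex) \<Rightarrow> (complex \<times> complex) set \<Rightarrow> bool"
  where "holomorphic2_on f S \<longleftrightarrow>
    (\<forall>z\<in>S. \<exists>a b. (f has_derivative (\<lambda>(s, t). a * s + b * t)) (at z))"

text \<open>
  Meromorphic on an open set: locally a quotient of holomorphic functions. The neighbourhood
  is connected, so a denominator with a non-zero value does not vanish on any non-empty open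
  subset. The values at zeros of the denominator are arbitrary, as for the library notion
  \<open>meromorphic_on\<close> in one variable.
\<close>

definition meromorphic2_on :: "(complex \<times> complex \<Rightarrow> complex) \<Rightarrow> (complex \<times> complex) set \<Rightarrow> bool"
  where "meromorphic2_on f D \<longleftrightarrow> open D \<and>
    (\<forall>z\<in>D. \<exists>U g h. open U \<and> connected U \<and> z \<in> U \<and> U \<subseteq> D \<and>
       holomorphic2_on g U \<and> holomorphic2_on h U \<and> (\<exists>w\<in>U. h w \<noteq> 0) \<and>
       (\<forall>w\<in>U. h w \<noteq> 0 \<longrightarrow> f w = g w / h w))"

definition dnum :: "(complex \<times> complex \<Rightarrow> complex) \<Rightarrow> real \<Rightarrow> real \<Rightarrow> real \<Rightarrow> complex"
  where "dnum R p q u = R (complex_of_real (p powr u), complex_of_real (q powr u))"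

definition dffact :: "(complex \<times> complex \<Rightarrow> complex) \<Rightarrow> real \<Rightarrow> real \<Rightarrow> real \<Rightarrow> nat \<Rightarrow> complex"
  where "dffact R p q u k = (\<Prod>v=1..k. dnum R p q (u - real v + 1))"

definition dfact :: "(complex \<times> complex \<Rightarrow> complex) \<Rightarrow> real \<Rightarrow> real \<Rightarrow> nat \<Rightarrow> complex"
  where "dfact R p q k = (\<Prod>j=1..k. dnum R p q (real j))"

definition dbinom :: "(complex \<times> complex \<Rightarrow> complex) \<Rightarrow> real \<Rightarrow> real \<Rightarrow> real \<Rightarrow> nat \<Rightarrow> complex"
  where "dbinom R p q u k = dffact R p q u k / dfact R p q k"

end

(*
  Evaluating [u + v] in two ways shows that [u] = c (e1^u - e2^u) with c = [1] / (e1 - e2). Hence,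
  with t = e2 / e1 in (0, 1) and m = n - 1, all powers of e1 cancel from the terms of the series and
  they become the Gaussian binomials [m + k choose k]_t times x^k.  These are at least 1 and bounded
  in k, so the series converges iff |x| < 1, and the t-Pascal rule, summed over k, gives
  S_(m+1) = S_m + t^(m+1) x S_(m+1) for the sums.
*)
theory Submission
  imports Defs
begin

text \<open>The Gaussian binomial \<open>[m + k choose k]_t\<close>. With \<open>m\<close> fixed,
  passing from \<open>k\<close> to \<open>Suc k\<close> multiplies it by a single factor.\<close>

definition gauss_binom :: "real \<Rightarrow> nat \<Rightarrow> nat \<Rightarrow> real"
  where "gauss_binom t m k = (\<Prod>j=1..k. (1 - t ^ (m + j)) / (1 - t ^ j))"

lemma gauss_binom_0_right [simp]: "gauss_binom t m 0 = 1"
  by (simp add: gauss_binom_def)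

lemma gauss_binom_Suc_right:
  "gauss_binom t m (Suc k) = gauss_binom t m k * ((1 - t ^ (m + Suc k)) / (1 - t ^ Suc k))"
  by (simp add: gauss_binom_def)

context
  fixes t :: real
  assumes t: "0 < t" "t < 1"
begin

lemma power_Suc_less_1: "t ^ Suc k < 1"
  using t by (intro power_Suc_less_one) auto

lemma gauss_binom_0_left: "gauss_binom t 0 k = 1"
proof (induction k)
  case (Suc k)
  then show ?case using power_Suc_less_1[of k] by (simp add: gauss_binom_Suc_right)
qed simp

text \<open>Every factor of the product is at least 1, since \<open>t ^ (m + j) \<le> t ^ j\<close>.
  This gives the signs for the comparison tests and the lower bound on the terms when
  \<open>\<bar>x\<bar> \<ge> 1\<close>.\<close>

lemma gauss_binom_ge_1: "gauss_binom t m k \<ge> 1"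
proof (induction k)
  case (Suc k)
  have "t ^ (m + Suc k) \<le> t ^ Suc k"
    using t by (intro power_decreasing) auto
  then have "(1 - t ^ (m + Suc k)) / (1 - t ^ Suc k) \<ge> 1"
    using power_Suc_less_1[of k] by (simp add: field_simps)
  with Suc show ?case
    unfolding gauss_binom_Suc_right using mult_mono[of 1 "gauss_binom t m k" 1] by (simp only: mult_1)
qed simp

text \<open>Raising \<open>m\<close> by one shifts the numerators of the product by one place, so
  only the first and the last of them fail to cancel.\<close>

lemma gauss_binom_absorb:
  "gauss_binom t (Suc m) k * (1 - t ^ Suc m) = gauss_binom t m k * (1 - t ^ (Suc m + k))"
proof (induction k)
  case (Suc k)
  have "gauss_binom t (Suc m) (Suc k) * (1 - t ^ Suc m)
      = (gauss_binom t (Suc m) k * (1 - t ^ Suc m)) * ((1 - t ^ (Suc m + Suc k)) / (1 - t ^ Suc k))"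
    unfolding gauss_binom_Suc_right by (simp only: mult_ac)
  also have "\<dots> = gauss_binom t m (Suc k) * (1 - t ^ (Suc m + Suc k))"
    unfolding Suc gauss_binom_Suc_right by simp
  finally show ?case .
qed simp

text \<open>Absorption expresses all three binomials through the common numerator \<open>A\<close>;
  what remains is \<open>1 - T * K = (1 - T) + T * (1 - K)\<close>.\<close>

lemma gauss_binom_pascal:
  "gauss_binom t (Suc m) (Suc k) = gauss_binom t m (Suc k) + t ^ Suc m * gauss_binom t (Suc m) k"
proof -
  define A where "A = gauss_binom t m k * (1 - t ^ (Suc m + k))"
  define T K where "T = t ^ Suc m" and "K = t ^ Suc k"
  have ne: "1 - T \<noteq> 0" "1 - K \<noteq> 0"
    using power_Suc_less_1[of m] power_Suc_less_1[of k] by (simp_all add: T_def K_def)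
  have TK: "t ^ (Suc m + Suc k) = T * K"
    by (simp only: T_def K_def power_add)
  have *: "gauss_binom t m (Suc k) = A / (1 - K)"
    by (simp add: gauss_binom_Suc_right A_def K_def)
  have "gauss_binom t (Suc m) (Suc k) = A / (1 - K) * (1 - T * K) / (1 - T)"
    using gauss_binom_absorb[of m "Suc k"] ne unfolding TK * T_def[symmetric]
    by (simp add: eq_divide_eq mult_ac)
  moreover have "gauss_binom t (Suc m) k = A / (1 - T)"
    using gauss_binom_absorb[of m k] ne unfolding A_def[symmetric] T_def[symmetric]
    by (simp add: eq_divide_eq)
  moreover have "A / (1 - K) * (1 - T * K) / (1 - T) = A / (1 - K) + T * (A / (1 - T))"
    using ne by (simp add: divide_simps) (simp add: algebra_simps)
  ultimately show ?thesis
    by (simp only: * T_def[symmetric])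
qed

text \<open>Absorption with the factor \<open>1 - t ^ (Suc m + k)\<close> bounded by 1. The
  denominator does not depend on \<open>k\<close>, so summability passes from \<open>m\<close> to
  \<open>Suc m\<close>.\<close>

lemma gauss_binom_Suc_le: "gauss_binom t (Suc m) k \<le> gauss_binom t m k / (1 - t ^ Suc m)"
proof -
  have "gauss_binom t m k * (1 - t ^ (Suc m + k)) \<le> gauss_binom t m k * 1"
    using gauss_binom_ge_1[of m k] t by (intro mult_left_mono) auto
  then show ?thesis
    using gauss_binom_absorb[of m k] power_Suc_less_1[of m] by (simp add: le_divide_eq)
qed

lemma summable_gauss_binom:
  assumes x: "\<bar>x\<bar> < 1"
  shows "summable (\<lambda>k. gauss_binom t m k * x ^ k)"
proof -
  \<comment> \<open>The induction runs on the series of absolute values, starting from the geometric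
    series; the signs of \<open>x\<close> return by comparison.\<close>
  have "summable (\<lambda>k. gauss_binom t m k * \<bar>x\<bar> ^ k)"
  proof (induction m)
    case 0
    show ?case using x by (simp add: gauss_binom_0_left summable_geometric)
  next
    case (Suc m)
    have "norm (gauss_binom t (Suc m) k * \<bar>x\<bar> ^ k)
        \<le> gauss_binom t m k * \<bar>x\<bar> ^ k / (1 - t ^ Suc m)" for k
      using mult_right_mono[OF gauss_binom_Suc_le[of m k], of "\<bar>x\<bar> ^ k"] gauss_binom_ge_1[of "Suc m" k]
      by (simp add: abs_mult)
    then show ?case
      by (intro summable_comparison_test'[OF summable_divide[OF Suc]])
  qed
  then show ?thesis
    by (rule summable_comparison_test'[where N = 0])
       (use gauss_binom_ge_1[of m] in \<open>simp add: abs_mult power_abs order_trans[OF zero_le_one]\<close>)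
qed

lemma summable_gauss_binom_iff:
  "summable (\<lambda>k. gauss_binom t m k * x ^ k) \<longleftrightarrow> \<bar>x\<bar> < 1"
proof
  assume "summable (\<lambda>k. gauss_binom t m k * x ^ k)"
  then have "(\<lambda>k. gauss_binom t m k * x ^ k) \<longlonglongrightarrow> 0"
    by (rule summable_LIMSEQ_zero)
  then obtain k where k: "norm (gauss_binom t m k * x ^ k) < 1"
    using LIMSEQ_D[of _ 0 1] by fastforce
  show "\<bar>x\<bar> < 1"
  proof (rule ccontr)
    assume "\<not> \<bar>x\<bar> < 1"
    then have "1 * 1 \<le> gauss_binom t m k * \<bar>x\<bar> ^ k"
      using gauss_binom_ge_1[of m k] by (intro mult_mono one_le_power) auto
    with k gauss_binom_ge_1[of m k] show False
      by (simp add: abs_mult power_abs)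
  qed
qed (rule summable_gauss_binom)

lemma gauss_binom_sums:
  assumes x: "\<bar>x\<bar> < 1"
  shows "(\<lambda>k. gauss_binom t m k * x ^ k) sums (\<Prod>i\<le>m. inverse (1 - x * t ^ i))"
proof (induction m)
  case 0
  show ?case
    using geometric_sums[of x] x by (simp add: gauss_binom_0_left inverse_eq_divide)
next
  case (Suc m)
  define S where "S = (\<Sum>k. gauss_binom t (Suc m) k * x ^ k)"
  define P where "P = (\<Prod>i\<le>m. inverse (1 - x * t ^ i))"
  have S: "(\<lambda>k. gauss_binom t (Suc m) k * x ^ k) sums S"
    unfolding S_def using summable_gauss_binom[OF x] by (rule summable_sums)
  \<comment> \<open>The Pascal rule covers only positive lower indices, so the terms at 0, all equal
    to 1, are split off.\<close>
  have "(\<lambda>k. gauss_binom t m (Suc k) * x ^ Suc k) sums (P - 1)"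
    using Suc unfolding P_def[symmetric] by (subst sums_Suc_iff) simp
  from sums_add[OF this sums_mult[OF S, of "t ^ Suc m * x"]]
  have "(\<lambda>k. gauss_binom t (Suc m) (Suc k) * x ^ Suc k) sums (P - 1 + t ^ Suc m * x * S)"
    by (simp add: gauss_binom_pascal algebra_simps)
  moreover have "(\<lambda>k. gauss_binom t (Suc m) (Suc k) * x ^ Suc k) sums (S - 1)"
    using S by (subst sums_Suc_iff) simp
  ultimately have "P - 1 + t ^ Suc m * x * S = S - 1"
    by (rule sums_unique2)
  then have "S * (1 - x * t ^ Suc m) = P"
    by (simp only: algebra_simps)
  moreover have "\<bar>x * t ^ Suc m\<bar> < 1"
    using mult_strict_mono'[of "\<bar>x\<bar>" 1 "t ^ Suc m" 1] x power_Suc_less_1[of m] t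
    by (simp add: abs_mult)
  then have "1 - x * t ^ Suc m \<noteq> 0" by linarith
  ultimately have "S = (\<Prod>i\<le>Suc m. inverse (1 - x * t ^ i))"
    by (simp add: P_def[symmetric] eq_divide_eq flip: divide_inverse)
  with S show ?case by simp
qed

end

lemma dnum_closed_form:
  assumes pos: "a > 0" "b > 0" "a \<noteq> b"
    and add: "\<And>u v. dnum R p q (u + v) =
           complex_of_real (a powr v) * dnum R p q u + complex_of_real (b powr u) * dnum R p q v"
  shows "dnum R p q u = dnum R p q 1 / complex_of_real (a - b) * complex_of_real (a powr u - b powr u)"
proof -
  \<comment> \<open>Expanding both sides by the addition law gives
    \<open>a [u] + b^u [1] = a^u [1] + b [u]\<close>, which is solved for
    \<open>[u]\<close>.\<close>
  have "dnum R p q (u + 1) = dnum R p q (1 + u)"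
    by (simp add: add.commute)
  then have "dnum R p q u * complex_of_real (a - b)
      = dnum R p q 1 * complex_of_real (a powr u - b powr u)"
    unfolding add using pos by (simp add: algebra_simps)
  moreover have "complex_of_real (a - b) \<noteq> 0"
    using pos by (simp del: of_real_diff)
  ultimately show ?thesis by (simp add: field_simps del: of_real_diff)
qed

lemma dbinom_eq_prod:
  "dbinom R p q (real (Suc m + k - 1)) k
     = (\<Prod>j=1..k. dnum R p q (real (m + j)) / dnum R p q (real j))"
proof -
  have "dffact R p q (real (Suc m + k - 1)) k = (\<Prod>j=1..k. dnum R p q (real (m + j)))"
    unfolding dffact_def
    \<comment> \<open>The deformed factorial descends from \<open>[m + k]\<close> to
      \<open>[m + 1]\<close>; reversing the index makes it ascend like \<open>dfact\<close>.\<close>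
    by (rule prod.reindex_bij_witness[of _ "\<lambda>j. Suc k - j" "\<lambda>j. Suc k - j"])
       (auto simp: of_nat_diff algebra_simps)
  then show ?thesis
    by (simp add: dbinom_def dfact_def prod_dividef)
qed

text \<open>Since \<open>[i] = c a^i (1 - (b/a)^i)\<close> with \<open>c \<noteq> 0\<close>, the
  constant cancels in each of the \<open>k\<close> quotients, and each contributes one factor
  \<open>a ^ m\<close>.\<close>

lemma dbinom_gauss_binom:
  assumes ab: "a > 0" "b > 0" "b < a"
    and add: "\<And>u v. dnum R p q (u + v) =
           complex_of_real (a powr v) * dnum R p q u + complex_of_real (b powr u) * dnum R p q v"
    and nz: "dnum R p q 1 \<noteq> 0"
  shows "dbinom R p q (real (Suc m + k - 1)) k = complex_of_real (a ^ (m * k) * gauss_binom (b / a) m k)"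
proof -
  define c where "c = dnum R p q 1 / complex_of_real (a - b)"
  have c: "c \<noteq> 0"
    using nz ab by (simp add: c_def del: of_real_diff)
  have num: "dnum R p q (real i) = c * complex_of_real (a ^ i * (1 - (b / a) ^ i))" for i
    using dnum_closed_form[OF ab(1,2) _ add, of "real i"] ab
    by (simp add: c_def powr_realpow power_divide right_diff_distrib)
  \<comment> \<open>At \<open>j = 0\<close> both sides are 0, being divisions by zero.\<close>
  have quot: "dnum R p q (real (m + j)) / dnum R p q (real j)
      = complex_of_real (a ^ m * ((1 - (b / a) ^ (m + j)) / (1 - (b / a) ^ j)))" for j
    unfolding num using c ab by (simp add: power_add del: of_real_diff)
  show ?thesis
    unfolding dbinom_eq_prod quot gauss_binom_def
    by (simp only: of_real_prod[symmetric] prod.distrib power_mult) simp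
qed

text \<open>Taking \<open>a ^ i\<close> out of the factor at \<open>r = i + 1\<close> leaves the
  t-product with \<open>t = b / a\<close>; the exponents add up to \<open>0 + ... + m\<close>, which
  is the binomial coefficient.\<close>

lemma prod_inverse_scale:
  fixes a b x :: real
  assumes "a > 0"
  shows "(\<Prod>r=1..Suc m. inverse (a ^ (r - 1) - x * b ^ (r - 1)))
    = a powi (- int (Suc m choose 2)) * (\<Prod>i\<le>m. inverse (1 - x * (b / a) ^ i))"
proof -
  have "(\<Prod>r=1..Suc m. inverse (a ^ (r - 1) - x * b ^ (r - 1)))
      = (\<Prod>i\<le>m. inverse (a ^ i - x * b ^ i))"
    by (rule prod.reindex_bij_witness[of _ Suc "\<lambda>r. r - 1"]) auto
  also have "\<dots> = (\<Prod>i\<le>m. inverse (a ^ i) * inverse (1 - x * (b / a) ^ i))"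
    using assms by (intro prod.cong refl)
      (simp add: power_divide right_diff_distrib flip: inverse_mult_distrib)
  also have "\<dots> = inverse (a ^ (\<Sum>i\<le>m. i)) * (\<Prod>i\<le>m. inverse (1 - x * (b / a) ^ i))"
    by (simp add: prod.distrib power_sum flip: prod_inversef)
  also have "(\<Sum>i\<le>m. i) = Suc m choose 2"
    by (simp add: choose_two gauss_sum_nat atMost_atLeast0 mult.commute)
  finally show ?thesis
    by (simp add: power_int_minus)
qed

text \<open>The infinite sum has a meaning only where the series converges, so the exact range of
  convergence is asserted along with the identity on it.\<close>

theorem theorem3p18:
  fixes R :: "complex \<times> complex \<Rightarrow> complex"
    and D :: "(complex \<times> complex) set"
    and p q \<epsilon>\<^sub>1 \<epsilon>\<^sub>2 x :: real
    and n :: nat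
  assumes "0 < q" and "q < p" and "p \<le> 1"
    and "meromorphic2_on R D"
    and "\<And>u::real. (complex_of_real (p powr u), complex_of_real (q powr u)) \<in> D"
    and "\<epsilon>\<^sub>1 > 0" and "\<epsilon>\<^sub>2 > 0"
    and "\<And>u v::real. dnum R p q (u + v) =
           complex_of_real (\<epsilon>\<^sub>1 powr v) * dnum R p q u + complex_of_real (\<epsilon>\<^sub>2 powr u) * dnum R p q v"
    and "\<And>k::nat. k \<ge> 1 \<Longrightarrow> dnum R p q (real k) \<noteq> 0"
    and "n \<ge> 1"
    and "\<bar>\<epsilon>\<^sub>2\<bar> < \<bar>\<epsilon>\<^sub>1\<bar>"
  shows
    "(summable (\<lambda>\<kappa>::nat. complex_of_real (\<epsilon>\<^sub>1 powi (- (int \<kappa> * (int n - 1))))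
                 * dbinom R p q (real (n + \<kappa> - 1)) \<kappa> * complex_of_real x ^ \<kappa>)
        \<longleftrightarrow> \<bar>x\<bar> < 1) \<and>
     (\<bar>x\<bar> < 1 \<longrightarrow>
        complex_of_real (\<Prod>r=1..n. inverse (\<epsilon>\<^sub>1 ^ (r - 1) - x * \<epsilon>\<^sub>2 ^ (r - 1))) =
        complex_of_real (\<epsilon>\<^sub>1 powi (- int (n choose 2))) *
          (\<Sum>\<kappa>::nat. complex_of_real (\<epsilon>\<^sub>1 powi (- (int \<kappa> * (int n - 1))))
                 * dbinom R p q (real (n + \<kappa> - 1)) \<kappa> * complex_of_real x ^ \<kappa>))"
proof -
  note pos = \<open>\<epsilon>\<^sub>1 > 0\<close> \<open>\<epsilon>\<^sub>2 > 0\<close>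
  define t where "t = \<epsilon>\<^sub>2 / \<epsilon>\<^sub>1"
  have lt: "\<epsilon>\<^sub>2 < \<epsilon>\<^sub>1"
    using assms(11) pos by simp
  have t: "0 < t" "t < 1"
    using pos lt by (simp_all add: t_def)
  obtain m where n: "n = Suc m"
    using \<open>n \<ge> 1\<close> by (cases n) auto
  have nz: "dnum R p q 1 \<noteq> 0"
    using assms(9)[of 1] by simp
  \<comment> \<open>The prefactor cancels the power
    \<open>\<epsilon>\<^sub>1 ^ (m * \<kappa>)\<close> of the deformed binomial, so the complex
    series is the image of a real one.\<close>
  have summand: "complex_of_real (\<epsilon>\<^sub>1 powi (- (int \<kappa> * (int n - 1))))
      * dbinom R p q (real (n + \<kappa> - 1)) \<kappa> * complex_of_real x ^ \<kappa>
      = complex_of_real (gauss_binom t m \<kappa> * x ^ \<kappa>)" for \<kappa>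
  proof -
    have "\<epsilon>\<^sub>1 powi (- (int \<kappa> * (int n - 1))) = inverse (\<epsilon>\<^sub>1 ^ (m * \<kappa>))"
      using power_int_of_nat[of \<epsilon>\<^sub>1 "\<kappa> * m"]
      by (simp add: n power_int_minus mult.commute del: power_int_of_nat)
    then show ?thesis
      unfolding n dbinom_gauss_binom[OF pos lt assms(8) nz] t_def
      using pos by simp
  qed
  have "(\<Sum>\<kappa>. complex_of_real (gauss_binom t m \<kappa> * x ^ \<kappa>))
      = complex_of_real (\<Prod>i\<le>m. inverse (1 - x * t ^ i))" if "\<bar>x\<bar> < 1"
    by (rule sums_unique[symmetric], rule sums_of_real, rule gauss_binom_sums[OF t that])
  then show ?thesis
    unfolding summand summable_of_real_iff summable_gauss_binom_iff[OF t]
    using prod_inverse_scale[OF pos(1), of x \<epsilon>\<^sub>2 m] by (simp only: n t_def of_real_mult) simp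
qed

end
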